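(* Let $n\ge2$ and $d\ge1$ be integers, and let $u_1,\dots,u_n\in(2\mathbb{Z}_{\ge 0})^n$ be points each of whose coordinate sums equals $2d$, such that $\mathcal U=\mathrm{conv}\{u_1,\dots,u_n\}$ is an $(n-1)$-dimensional simplex. If $k$ is an integer with $k\ge n-1$, then $k\mathcal U\cap\mathbb{Z}^n$ is $(k\mathcal U)$-mediated.
   Context: For a simplex $\mathcal V=\mathrm{conv}\{v_1,\dots,v_n\}$ with vertices $v_i\in(2\mathbb{Z})^n$, a set $S\subseteq \mathcal V\cap\mathbb{Z}^n$ containing all vertices $v_i$ is called $\mathcal V$-mediated if every $y\in S$ either equals some vertex $v_i$, or there exist $z_1\neq z_2$ in $S\cap(2\mathbb{Z})^n$ with $y=\tfrac12(z_1+z_2)$. Here $k\mathcal U$ is the simplex with vertices $ku_1,\dots,ku_n$. *)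

theory Defs
  imports "HOL-Analysis.Analysis"
begin

definition int_lattice :: "(real ^ 'n) set"
  where "int_lattice = {x. \<forall>i. x $ i \<in> \<int>}"

definition even_lattice :: "(real ^ 'n) set"
  where "even_lattice = (\<lambda>x. 2 *\<^sub>R x) ` int_lattice"

text \<open>
  The simplex \<open>\<V>\<close> is represented by its vertex family \<open>v\<close>, so that
  \<open>\<V> = convex hull (range v)\<close>. The notion is meant for affinely independent
  vertices in the even lattice.
\<close>

definition mediated :: "('n \<Rightarrow> real ^ 'n) \<Rightarrow> (real ^ 'n) set \<Rightarrow> bool"
  where "mediated v S \<longleftrightarrow>
    S \<subseteq> convex hull (range v) \<inter> int_lattice \<and>
    range v \<subseteq> S \<and>
    (\<forall>y\<in>S. y \<in> range v \<or>
      (\<exists>z1 \<in> S \<inter> even_lattice. \<exists>z2 \<in> S \<inter> even_lattice.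
        z1 \<noteq> z2 \<and> y = (1 / 2) *\<^sub>R (z1 + z2)))"

end

theory Submission
  imports Defs
begin

text \<open>
  Write a lattice point of \<open>k\<U>\<close> as \<open>y = \<Sum>i. l i u i\<close> with \<open>l \<ge> 0\<close> of total mass \<open>k\<close>. The numbers
  \<open>\<lfloor>2 l i\<rfloor>\<close> add up to more than \<open>2 k - n\<close>, hence to at least \<open>k\<close>, so there are natural numbers
  \<open>m i \<le> 2 l i\<close> with sum exactly \<open>k\<close>. Then \<open>z = \<Sum>i. m i u i\<close> and \<open>2 y - z\<close> are even points of \<open>k\<U>\<close>
  with midpoint \<open>y\<close>. They coincide only if \<open>y = \<Sum>i. m i u i\<close>; in that case, unless \<open>y\<close> is a vertex,
  two coefficients \<open>m i\<close>, \<open>m j\<close> are positive and \<open>y\<close> is the midpoint of \<open>y \<plusminus> (u i - u j)\<close>.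
\<close>

text \<open>Greedy filling: the new index takes as much of \<open>k\<close> as its bound allows, and
  the induction hypothesis, with \<open>k\<close> generalised, distributes the rest.\<close>

lemma exists_nat_le_sum_eq:
  fixes f :: "'a \<Rightarrow> nat"
  assumes "finite A" "k \<le> sum f A"
  shows "\<exists>m. (\<forall>i\<in>A. m i \<le> f i) \<and> sum m A = k"
  using assms
proof (induction A arbitrary: k rule: finite_induct)
  case empty
  then show ?case by simp
next
  case (insert a A)
  have "k - min k (f a) \<le> sum f A" using insert by auto
  then obtain m where m: "\<forall>i\<in>A. m i \<le> f i" "sum m A = k - min k (f a)"
    using insert.IH by blast
  have "sum (m(a := min k (f a))) A = sum m A"
    using insert.hyps by (intro sum.cong) auto
  then have "sum (m(a := min k (f a))) (insert a A) = k" using insert.hyps m by simp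
  moreover have "\<forall>i\<in>insert a A. (m(a := min k (f a))) i \<le> f i" using m by simp
  ultimately show ?case by blast
qed

text \<open>Each floor loses strictly less than 1. Nonemptiness keeps the inequality strict after
  summation, and this strictness later gains the unit that makes \<open>k \<ge> n - 1\<close>
  suffice.\<close>

lemma sum_floor_gt:
  fixes f :: "'a \<Rightarrow> real"
  assumes "finite A" "A \<noteq> {}"
  shows "sum f A - real (card A) < real_of_int (\<Sum>i\<in>A. \<lfloor>f i\<rfloor>)"
proof -
  have "(\<Sum>i\<in>A. f i - 1) < (\<Sum>i\<in>A. real_of_int \<lfloor>f i\<rfloor>)"
    using assms by (intro sum_strict_mono) linarith+
  then show ?thesis by (simp add: sum_subtractf)
qed

lemma int_lattice_add: "x \<in> int_lattice \<Longrightarrow> y \<in> int_lattice \<Longrightarrow> x + y \<in> int_lattice"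
  by (simp add: int_lattice_def)

lemma int_lattice_scaleR: "a \<in> \<int> \<Longrightarrow> x \<in> int_lattice \<Longrightarrow> a *\<^sub>R x \<in> int_lattice"
  by (simp add: int_lattice_def)

lemma even_lattice_double: "x \<in> int_lattice \<Longrightarrow> 2 *\<^sub>R x \<in> even_lattice"
  by (simp add: even_lattice_def)

lemma even_lattice_add:
  assumes "x \<in> even_lattice" "y \<in> even_lattice"
  shows "x + y \<in> even_lattice"
proof -
  obtain a b where "x = 2 *\<^sub>R a" "y = 2 *\<^sub>R b" "a \<in> int_lattice" "b \<in> int_lattice"
    using assms by (auto simp: even_lattice_def)
  then have "x + y = 2 *\<^sub>R (a + b)" "a + b \<in> int_lattice"
    by (auto simp: scaleR_add_right int_lattice_add)
  then show ?thesis by (simp add: even_lattice_double)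
qed

lemma even_lattice_scaleR:
  assumes "c \<in> \<int>" "x \<in> even_lattice"
  shows "c *\<^sub>R x \<in> even_lattice"
proof -
  obtain a where "x = 2 *\<^sub>R a" "a \<in> int_lattice"
    using assms by (auto simp: even_lattice_def)
  then have "c *\<^sub>R x = 2 *\<^sub>R (c *\<^sub>R a)" "c *\<^sub>R a \<in> int_lattice"
    using assms by (auto simp: int_lattice_scaleR)
  then show ?thesis by (metis even_lattice_double)
qed

lemma even_lattice_diff: "x \<in> even_lattice \<Longrightarrow> y \<in> even_lattice \<Longrightarrow> x - y \<in> even_lattice"
  using even_lattice_add[of x "(-1) *\<^sub>R y"] even_lattice_scaleR[of "-1" y] by simp

lemma even_lattice_sum:
  assumes "\<And>i. i \<in> A \<Longrightarrow> f i \<in> even_lattice"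
  shows "sum f A \<in> even_lattice"
  using assms
proof (induction A rule: infinite_finite_induct)
  case (insert a A)
  then show ?case by (simp add: even_lattice_add)
qed (use even_lattice_double[of 0] in \<open>simp_all add: int_lattice_def\<close>)

lemma even_lattice_subset: "even_lattice \<subseteq> int_lattice"
  by (auto simp: even_lattice_def intro!: int_lattice_scaleR)

text \<open>\<open>simplex\<close> only provides some affinely independent \<open>C\<close> with the
  same hull. Points of \<open>C\<close> are extreme points of that hull, so they lie among the
  \<open>u i\<close>; as \<open>C\<close> has as many points as there are indices, no two
  \<open>u i\<close> coincide.\<close>

lemma simplex_convex_hull_range_inj:
  fixes u :: "'i::finite \<Rightarrow> 'a::euclidean_space"
  assumes "(int CARD('i) - 1) simplex (convex hull (range u))"
  shows "inj u"
proof -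
  obtain C where C: "\<not> affine_dependent C" "int (card C) = int CARD('i)"
      "convex hull (range u) = convex hull C"
    using assms by (auto simp: simplex_def)
  have "C \<subseteq> range u"
  proof
    fix x assume "x \<in> C"
    then have "x extreme_point_of (convex hull (range u))"
      using C extreme_point_of_convex_hull_affine_independent by metis
    then show "x \<in> range u" by (rule extreme_point_of_convex_hull)
  qed
  then have "CARD('i) \<le> card (range u)" using C card_mono[of "range u" C] by simp
  then show ?thesis using card_image_le[of UNIV u] by (auto intro!: eq_card_imp_inj_on)
qed

text \<open>Absorbs the factor \<open>c\<close> into the weights, so that they have total mass
  \<open>c\<close> and can be compared with integers. Injectivity lets weights on points be
  reindexed as weights on indices.\<close>

lemma mem_convex_hull_scaled_range:
  fixes u :: "'i::finite \<Rightarrow> 'a::real_vector"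
  assumes "inj u" "c > 0"
  shows "y \<in> convex hull (range (\<lambda>i. c *\<^sub>R u i)) \<longleftrightarrow>
    (\<exists>l. (\<forall>i. l i \<ge> 0) \<and> sum l UNIV = c \<and> y = (\<Sum>i\<in>UNIV. l i *\<^sub>R u i))"
proof
  have inj: "inj (\<lambda>i. c *\<^sub>R u i)" using assms by (auto simp: inj_def)
  assume "y \<in> convex hull (range (\<lambda>i. c *\<^sub>R u i))"
  then obtain g where g: "\<forall>x\<in>range (\<lambda>i. c *\<^sub>R u i). 0 \<le> g x" "sum g (range (\<lambda>i. c *\<^sub>R u i)) = 1"
      "(\<Sum>x\<in>range (\<lambda>i. c *\<^sub>R u i). g x *\<^sub>R x) = y"
    by (auto simp: convex_hull_finite)
  define l where "l i = c * g (c *\<^sub>R u i)" for i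
  have "sum l UNIV = c" using g(2) inj
    by (simp add: l_def sum.reindex flip: sum_distrib_left)
  moreover have "y = (\<Sum>i\<in>UNIV. l i *\<^sub>R u i)" using g(3) inj
    by (simp add: l_def sum.reindex mult.commute)
  moreover have "\<forall>i. l i \<ge> 0" using g(1) assms by (simp add: l_def)
  ultimately show "\<exists>l. (\<forall>i. l i \<ge> 0) \<and> sum l UNIV = c \<and> y = (\<Sum>i\<in>UNIV. l i *\<^sub>R u i)"
    by blast
next
  assume "\<exists>l. (\<forall>i. l i \<ge> 0) \<and> sum l UNIV = c \<and> y = (\<Sum>i\<in>UNIV. l i *\<^sub>R u i)"
  then obtain l where l: "\<forall>i. l i \<ge> 0" "sum l UNIV = c" "y = (\<Sum>i\<in>UNIV. l i *\<^sub>R u i)"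
    by blast
  have "(\<Sum>i\<in>UNIV. (l i / c) *\<^sub>R (c *\<^sub>R u i)) \<in> convex hull (range (\<lambda>i. c *\<^sub>R u i))"
    using l assms by (intro convex_sum) (auto intro: hull_inc simp flip: sum_divide_distrib)
  then show "y \<in> convex hull (range (\<lambda>i. c *\<^sub>R u i))" using l assms by simp
qed

theorem theorem3p5:
  fixes u :: "'n::finite \<Rightarrow> real ^ 'n" and d k :: int
  assumes "CARD('n) \<ge> 2"
    and "d \<ge> 1"
    and "\<And>i. u i \<in> even_lattice"
    and "\<And>i j. u i $ j \<ge> 0"
    and "\<And>i. (\<Sum>j\<in>UNIV. u i $ j) = 2 * of_int d"
    and "(int CARD('n) - 1) simplex (convex hull (range u))"
    and "k \<ge> int CARD('n) - 1"
  shows "mediated (\<lambda>i. of_int k *\<^sub>R u i)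
    (convex hull (range (\<lambda>i. of_int k *\<^sub>R u i)) \<inter> int_lattice)"
proof -
  let ?H = "convex hull (range (\<lambda>i. of_int k *\<^sub>R u i))"
  have inj: "inj u" using assms(6) by (rule simplex_convex_hull_range_inj)
  have k: "k \<ge> 1" using assms(1,7) by linarith
  then have mem: "y \<in> ?H \<longleftrightarrow>
      (\<exists>l. (\<forall>i. l i \<ge> 0) \<and> sum l UNIV = of_int k \<and> y = (\<Sum>i\<in>UNIV. l i *\<^sub>R u i))" for y
    using mem_convex_hull_scaled_range[OF inj] by simp
  have vertices: "range (\<lambda>i. of_int k *\<^sub>R u i) \<subseteq> ?H \<inter> int_lattice"
    using assms(3) even_lattice_subset by (auto intro!: hull_inc int_lattice_scaleR)
  \<comment> \<open>Both non-vertex cases below end here: the second endpoint is the reflection of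
    \<open>z\<close> in \<open>y\<close>, which is even because \<open>2 y\<close> and
    \<open>z\<close> are.\<close>
  have midpoint: "\<exists>z1 \<in> ?H \<inter> int_lattice \<inter> even_lattice. \<exists>z2 \<in> ?H \<inter> int_lattice \<inter> even_lattice.
      z1 \<noteq> z2 \<and> y = (1 / 2) *\<^sub>R (z1 + z2)"
    if "z \<in> ?H" "2 *\<^sub>R y - z \<in> ?H" "z \<in> even_lattice" "y \<in> int_lattice" "z \<noteq> y" for y z
  proof -
    have "2 *\<^sub>R y - z \<in> even_lattice"
      using that by (simp add: even_lattice_diff even_lattice_double)
    moreover have "z \<noteq> 2 *\<^sub>R y - z"
    proof
      assume "z = 2 *\<^sub>R y - z"
      then have "2 *\<^sub>R z = 2 *\<^sub>R y" unfolding eq_diff_eq scaleR_2 .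
      then show False using that by simp
    qed
    moreover have "y = (1 / 2) *\<^sub>R (z + (2 *\<^sub>R y - z))" by simp
    ultimately show ?thesis using that even_lattice_subset
      by (intro bexI[of _ z] bexI[of _ "2 *\<^sub>R y - z"]) auto
  qed
  have "y \<in> range (\<lambda>i. of_int k *\<^sub>R u i) \<or>
      (\<exists>z1 \<in> ?H \<inter> int_lattice \<inter> even_lattice. \<exists>z2 \<in> ?H \<inter> int_lattice \<inter> even_lattice.
        z1 \<noteq> z2 \<and> y = (1 / 2) *\<^sub>R (z1 + z2))"
    if y: "y \<in> ?H \<inter> int_lattice" for y
  proof -
    obtain l where l: "\<forall>i. l i \<ge> 0" "sum l UNIV = of_int k" "y = (\<Sum>i\<in>UNIV. l i *\<^sub>R u i)"
      using IntD1[OF y] unfolding mem by blast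
    have "2 * of_int k - real CARD('n) < real_of_int (\<Sum>i\<in>UNIV. \<lfloor>2 * l i\<rfloor>)"
      using sum_floor_gt[of UNIV "\<lambda>i. 2 * l i"] l(2) by (simp flip: sum_distrib_left)
    \<comment> \<open>The sum is an integer above \<open>2 k - n\<close>, so it is at least
      \<open>2 k - n + 1\<close>, and this is at least \<open>k\<close> since
      \<open>k \<ge> n - 1\<close>.\<close>
    then have "k \<le> (\<Sum>i\<in>UNIV. \<lfloor>2 * l i\<rfloor>)" using assms(7) by linarith
    also have "\<dots> = int (\<Sum>i\<in>UNIV. nat \<lfloor>2 * l i\<rfloor>)" using l(1) by simp
    finally have "nat k \<le> (\<Sum>i\<in>UNIV. nat \<lfloor>2 * l i\<rfloor>)" by linarith
    from exists_nat_le_sum_eq[OF finite this]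
    obtain m where m: "\<And>i. m i \<le> nat \<lfloor>2 * l i\<rfloor>" "sum m UNIV = nat k" by auto
    have m_le: "real (m i) \<le> 2 * l i" for i using m(1)[of i] l(1)[rule_format, of i] by linarith
    have sum_m: "(\<Sum>i\<in>UNIV. real (m i)) = of_int k" using m(2) k by (simp flip: of_nat_sum)
    define z where "z = (\<Sum>i\<in>UNIV. real (m i) *\<^sub>R u i)"
    have z_even: "z \<in> even_lattice"
      unfolding z_def using assms(3) by (intro even_lattice_sum even_lattice_scaleR) auto
    show ?thesis
    proof (cases "z = y")
      case False
      have "z \<in> ?H" unfolding z_def mem using sum_m by (intro exI[of _ "\<lambda>i. real (m i)"]) simp
      \<comment> \<open>These coefficients are nonnegative by \<open>m_le\<close> and have total
        mass \<open>2 k - k = k\<close>.\<close>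
      moreover have "2 *\<^sub>R y - z = (\<Sum>i\<in>UNIV. (2 * l i - real (m i)) *\<^sub>R u i)"
        by (simp add: z_def l(3) scaleR_diff_left sum_subtractf scaleR_sum_right)
      then have "2 *\<^sub>R y - z \<in> ?H" unfolding mem using sum_m l(2) m_le
        by (intro exI[of _ "\<lambda>i. 2 * l i - real (m i)"])
          (simp add: sum_subtractf flip: sum_distrib_left)
      ultimately show ?thesis using y z_even False by (intro disjI2 midpoint[of z]) auto
    next
      case True
      obtain i where i: "m i > 0"
      proof -
        have "sum m UNIV \<noteq> 0" using m(2) k by simp
        then show ?thesis using that by (metis gr0I sum.neutral)
      qed
      show ?thesis
      proof (cases "\<exists>j. j \<noteq> i \<and> m j > 0")
        case False
        \<comment> \<open>The whole mass \<open>k\<close> sits on \<open>i\<close>, so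
          \<open>y\<close> is a vertex.\<close>
        then have "sum m (UNIV - {i}) = 0" by auto
        then have "m j = (if j = i then nat k else 0)" for j
          using False m(2) sum.remove[of UNIV i m] by auto
        then have "z = (\<Sum>j\<in>UNIV. if j = i then of_int k *\<^sub>R u i else 0)"
          unfolding z_def using k by (intro sum.cong) auto
        then have "y = of_int k *\<^sub>R u i" using True by simp
        then show ?thesis by (intro disjI1) blast
      next
        case other: True
        then obtain j where j: "j \<noteq> i" "m j > 0" by blast
        \<comment> \<open>Since \<open>y = z\<close>, the \<open>m r\<close> are coefficients of
          \<open>y\<close>. Moving one unit of mass from \<open>b\<close> to \<open>a\<close> keeps
          the total, and \<open>m b\<close> is a positive integer, so no coefficient becomes
          negative.\<close>
        have shift: "y + u a - u b \<in> ?H" if "a \<noteq> b" "m b > 0" for a b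
        proof -
          define c where "c r = real (m r) + (if r = a then 1 else 0) - (if r = b then 1 else 0)" for r
          have "(\<Sum>r\<in>UNIV. c r *\<^sub>R u r) = y + u a - u b"
            by (simp add: c_def True[symmetric] z_def scaleR_add_left scaleR_diff_left
                sum.distrib sum_subtractf if_distrib[of "\<lambda>t. t *\<^sub>R _"] cong: if_cong)
          moreover have "sum c UNIV = of_int k"
            by (simp add: c_def sum.distrib sum_subtractf sum_m)
          moreover have "\<forall>r. c r \<ge> 0" using that by (auto simp: c_def)
          ultimately show ?thesis unfolding mem by metis
        qed
        have "y + u i - u j \<in> ?H" using j by (intro shift) auto
        \<comment> \<open>The reflected point is \<open>y + u j - u i\<close>, the opposite shift,
          which is where \<open>m i > 0\<close> enters.\<close>
        moreover have "2 *\<^sub>R y - (y + u i - u j) \<in> ?H"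
          using shift[of j i] i j by (simp add: scaleR_2 algebra_simps)
        moreover have "y + u i - u j \<in> even_lattice"
          using z_even True assms(3) by (simp add: even_lattice_add even_lattice_diff)
        moreover have "y + u i - u j \<noteq> y" using inj j by (auto simp: inj_def algebra_simps)
        ultimately show ?thesis using y by (intro disjI2 midpoint[of "y + u i - u j"]) auto
      qed
    qed
  qed
  with vertices show ?thesis unfolding mediated_def by (intro conjI ballI) auto
qed

end
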